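(* Let $R=R(\theta)$ be the inclination equation of a plane curve, with $R$ smooth on an interval $I$, and consider its conormal caustic defined by a smooth field of tilting angles $\phi(\theta)$, $\theta\in I$, such that $\phi'\neq 1$ on $I$. Then the curve and the caustic are similar if and only if $R$ satisfies the functional differential equation $$\frac{1}{(1-\phi')^2}\left(\left((1-2\phi')\sin\phi+\frac{\phi''}{1-\phi'}\cos\phi\right)R+\cos\phi\,R'\right)=a\,R\left(\pm\left(\theta+\tfrac{\pi}{2}-\phi-\beta\right)\right)$$ for some real $a$ and $\beta$ and some choice of the sign $\pm$, where on the left-hand side $R,R',\phi,\phi',\phi''$ are evaluated at $\theta$, on the right-hand side $\phi=\phi(\theta)$, and primes denote derivatives with respect to $\theta$.
   Context: Curves in the plane may have cusps. The angle of inclination $\theta$ is the angle of the tangent of the curve with the $x$-axis; curves are parametrized by $\theta$. The unit tangent is $T(\theta)=(\cos\theta,\sin\theta)$, the unit normal is $N(\theta)=(-\sin\theta,\cos\theta)$, and the signed radius of curvature $R(\theta)$ is defined by $\frac{dr}{d\theta}=R(\theta)T(\theta)$; negative values are allowed. The equation $R=R(\theta)$ is called the inclination equation of the curve. Conormal caustic: given tilting angles $\phi(\theta)$, the ray at $r(\theta)$ is the line through $r(\theta)$ with unit direction $\nu(\theta)=\sin\phi\,T+\cos\phi\,N$. The conormal caustic is the envelope of these rays: the curve of points $c(\theta)=r(\theta)+t\nu(\theta)$, where $t=t(\theta)$ is determined by the condition that $\frac{\partial}{\partial\theta}(r+t\nu)$ (with $t$ fixed) is collinear with $\nu$. Its angle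 of inclination $\theta_1$ is that of the unit tangent $T_1=(\cos\theta_1,\sin\theta_1)=\nu$, i.e. $\theta_1=\theta+\frac{\pi}{2}-\phi(\theta)$, and its signed radius of curvature $R_1$ is defined by $\frac{dc}{d\theta_1}=R_1T_1$. Similarity: rotating a curve shifts its angle of inclination and changing the direction of measuring the angle switches its sign, so the curve and its caustic are called similar if there are real $a$ and $\beta$ and a choice of sign such that $R_1=a\,R(\pm(\theta_1-\beta))$ at every point of the caustic, where $R_1$ is the signed radius of curvature of the caustic at the point with angle of inclination $\theta_1$. In this identity and in the functional differential equation the argument of $R$ on the right-hand side is required to lie in the domain $I$ of $R$ for all $\theta\in I$. *)

theory Defs
  imports "HOL-Analysis.Analysis"
begin

text \<open>Derivatives are taken within the parameter interval, so they are one-sided at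
  endpoints belonging to it.\<close>

definition deriv_on :: "real set \<Rightarrow> (real \<Rightarrow> real) \<Rightarrow> real \<Rightarrow> real" where
  "deriv_on I f x = vector_derivative f (at x within I)"

definition smooth_on :: "real set \<Rightarrow> (real \<Rightarrow> real) \<Rightarrow> bool" where
  "smooth_on I f \<longleftrightarrow> (\<forall>n. (deriv_on I ^^ n) f differentiable_on I)"

definition tangent :: "real \<Rightarrow> real \<times> real" where
  "tangent \<theta> = (cos \<theta>, sin \<theta>)"

definition normal :: "real \<Rightarrow> real \<times> real" where
  "normal \<theta> = (- sin \<theta>, cos \<theta>)"

text \<open>The curve \<open>r\<close> is parametrized over \<open>I\<close> by its angle of inclination and has signed
  radius of curvature \<open>R\<close>, which may vanish (cusps) or be negative.\<close>

definition inclination_equation ::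
    "(real \<Rightarrow> real \<times> real) \<Rightarrow> real set \<Rightarrow> (real \<Rightarrow> real) \<Rightarrow> bool" where
  "inclination_equation r I R \<longleftrightarrow>
     (\<forall>\<theta>\<in>I. (r has_vector_derivative R \<theta> *\<^sub>R tangent \<theta>) (at \<theta> within I))"

definition ray_dir :: "(real \<Rightarrow> real) \<Rightarrow> real \<Rightarrow> real \<times> real" where
  "ray_dir \<phi> \<theta> = sin (\<phi> \<theta>) *\<^sub>R tangent \<theta> + cos (\<phi> \<theta>) *\<^sub>R normal \<theta>"

text \<open>In the condition determining the distance to the envelope along the ray at \<open>\<theta>\<close>,
  \<open>t\<close> is held fixed while \<open>s\<close> varies.\<close>

definition ray_length ::
    "(real \<Rightarrow> real \<times> real) \<Rightarrow> (real \<Rightarrow> real) \<Rightarrow> real set \<Rightarrow> real \<Rightarrow> real" where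
  "ray_length r \<phi> I \<theta> =
     (THE t. \<exists>v. ((\<lambda>s. r s + t *\<^sub>R ray_dir \<phi> s) has_vector_derivative v) (at \<theta> within I) \<and>
                 collinear {0, v, ray_dir \<phi> \<theta>})"

definition conormal_caustic ::
    "(real \<Rightarrow> real \<times> real) \<Rightarrow> (real \<Rightarrow> real) \<Rightarrow> real set \<Rightarrow> real \<Rightarrow> real \<times> real" where
  "conormal_caustic r \<phi> I \<theta> = r \<theta> + ray_length r \<phi> I \<theta> *\<^sub>R ray_dir \<phi> \<theta>"

text \<open>The angle of inclination of the caustic: \<open>tangent (caustic_angle \<phi> \<theta>) = ray_dir \<phi> \<theta>\<close>.\<close>

definition caustic_angle :: "(real \<Rightarrow> real) \<Rightarrow> real \<Rightarrow> real" where
  "caustic_angle \<phi> \<theta> = \<theta> + pi / 2 - \<phi> \<theta>"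

text \<open>The caustic reparametrized by its own angle of inclination, over \<open>caustic_angle \<phi> ` I\<close>.
  The angle is injective on an interval \<open>I\<close> on which \<open>\<phi>\<close> is differentiable with
  \<open>deriv_on I \<phi>\<close> never equal to \<open>1\<close>.\<close>

definition caustic_by_angle ::
    "(real \<Rightarrow> real \<times> real) \<Rightarrow> (real \<Rightarrow> real) \<Rightarrow> real set \<Rightarrow> real \<Rightarrow> real \<times> real" where
  "caustic_by_angle r \<phi> I = conormal_caustic r \<phi> I \<circ> inv_into I (caustic_angle \<phi>)"

text \<open>Both curves are parametrized by their angles of inclination; \<open>\<sigma>\<close> is the choice of sign,
  and the factor \<open>a\<close> may be zero.\<close>

definition similar_curves ::
    "(real \<Rightarrow> real \<times> real) \<Rightarrow> real set \<Rightarrow> (real \<Rightarrow> real \<times> real) \<Rightarrow> real set \<Rightarrow> bool" where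
  "similar_curves r I c J \<longleftrightarrow>
     (\<exists>R R\<^sub>1. inclination_equation r I R \<and> inclination_equation c J R\<^sub>1 \<and>
       (\<exists>a \<beta>. \<exists>\<sigma>\<in>{1, -1}. \<forall>\<theta>\<^sub>1\<in>J.
          \<sigma> * (\<theta>\<^sub>1 - \<beta>) \<in> I \<and> R\<^sub>1 \<theta>\<^sub>1 = a * R (\<sigma> * (\<theta>\<^sub>1 - \<beta>))))"

end

theory Submission
  imports Defs
begin

text \<open>With \<open>\<alpha> = \<theta> + \<pi>/2 - \<phi>\<close> the ray direction is \<open>T(\<alpha>)\<close>, whose derivative is
  \<open>(1 - \<phi>') N(\<alpha>)\<close>. Since \<open>T(\<theta>) = sin \<phi> T(\<alpha>) - cos \<phi> N(\<alpha>)\<close>, the envelope condition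
  kills the \<open>N(\<alpha>)\<close>-component of \<open>R T(\<theta>) + t (1 - \<phi>') N(\<alpha>)\<close>, so \<open>t = R cos \<phi> / (1 - \<phi>')\<close>.
  Then \<open>c' = (R sin \<phi> + t') T(\<alpha>)\<close>, and dividing by \<open>\<alpha>' = 1 - \<phi>'\<close> yields \<open>R\<^sub>1\<close>, which is the
  left-hand side of the functional equation.\<close>

section \<open>The orthonormal frame attached to the rays\<close>

lemma tangent_has_vector_derivative:
  assumes "(f has_real_derivative f') (at x within S)"
  shows "((\<lambda>x. tangent (f x)) has_vector_derivative f' *\<^sub>R normal (f x)) (at x within S)"
proof -
  have c: "((\<lambda>x. cos (f x)) has_real_derivative - sin (f x) * f') (at x within S)"
    and s: "((\<lambda>x. sin (f x)) has_real_derivative cos (f x) * f') (at x within S)"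
    using assms by (auto intro!: derivative_eq_intros)
  show ?thesis
    using has_vector_derivative_Pair[OF c[unfolded has_real_derivative_iff_has_vector_derivative]
        s[unfolded has_real_derivative_iff_has_vector_derivative]]
    by (simp add: tangent_def normal_def mult.commute)
qed

lemma ray_dir_eq_tangent: "ray_dir \<phi> \<theta> = tangent (caustic_angle \<phi> \<theta>)"
proof -
  have "caustic_angle \<phi> \<theta> = (\<theta> - \<phi> \<theta>) + pi / 2"
    by (simp add: caustic_angle_def)
  then show ?thesis
    by (simp only: sin_add cos_add tangent_def)
       (simp add: ray_dir_def tangent_def normal_def sin_diff cos_diff algebra_simps)
qed

text \<open>Used to split the velocity of \<open>r\<close> into components along and across the ray:
  the first contributes to the speed of the caustic, the second fixes the distance to the
  envelope.\<close>

lemma tangent_in_caustic_frame: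
  "tangent \<theta> = sin (\<phi> \<theta>) *\<^sub>R tangent (caustic_angle \<phi> \<theta>)
     - cos (\<phi> \<theta>) *\<^sub>R normal (caustic_angle \<phi> \<theta>)"
proof -
  have "\<theta> = caustic_angle \<phi> \<theta> + \<phi> \<theta> - pi / 2"
    by (simp add: caustic_angle_def)
  then have "tangent \<theta> = tangent (caustic_angle \<phi> \<theta> + \<phi> \<theta> - pi / 2)"
    by simp
  also have "\<dots> = sin (\<phi> \<theta>) *\<^sub>R tangent (caustic_angle \<phi> \<theta>)
     - cos (\<phi> \<theta>) *\<^sub>R normal (caustic_angle \<phi> \<theta>)"
    by (simp add: tangent_def normal_def sin_diff cos_diff sin_add cos_add algebra_simps)
  finally show ?thesis .
qed

lemma tangent_nonzero [simp]: "tangent \<theta> \<noteq> 0"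
  using sin_zero_abs_cos_one[of \<theta>] by (auto simp: tangent_def zero_prod_def)

lemma collinear_frame_iff:
  "collinear {0, x *\<^sub>R tangent \<theta> + y *\<^sub>R normal \<theta>, tangent \<theta>} \<longleftrightarrow> y = 0"
proof
  have one: "(cos \<theta>)\<^sup>2 + (sin \<theta>)\<^sup>2 = 1"
    by simp
  assume "collinear {0, x *\<^sub>R tangent \<theta> + y *\<^sub>R normal \<theta>, tangent \<theta>}"
  \<comment> \<open>With the nonzero vector \<open>tangent \<theta>\<close> in the second slot,
    \<open>collinear_lemma\<close> makes the other vector a multiple of it.\<close>
  then have "collinear {0, tangent \<theta>, x *\<^sub>R tangent \<theta> + y *\<^sub>R normal \<theta>}"
    by (simp add: insert_commute)
  then obtain c where "x *\<^sub>R tangent \<theta> + y *\<^sub>R normal \<theta> = c *\<^sub>R tangent \<theta>"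
    unfolding collinear_lemma by force
  then have "x * cos \<theta> - y * sin \<theta> = c * cos \<theta>" "x * sin \<theta> + y * cos \<theta> = c * sin \<theta>"
    by (simp_all add: tangent_def normal_def)
  \<comment> \<open>Pairing the vector equation with \<open>normal \<theta>\<close> eliminates both
    \<open>x\<close> and \<open>c\<close>.\<close>
  then have "y * ((cos \<theta>)\<^sup>2 + (sin \<theta>)\<^sup>2) = 0"
    by algebra
  then show "y = 0"
    by (simp only: one mult_1_right)
next
  assume "y = 0"
  then have "collinear {0, tangent \<theta>, x *\<^sub>R tangent \<theta> + y *\<^sub>R normal \<theta>}"
    unfolding collinear_lemma by auto
  then show "collinear {0, x *\<^sub>R tangent \<theta> + y *\<^sub>R normal \<theta>, tangent \<theta>}"
    by (simp add: insert_commute)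
qed

section \<open>Distance to the envelope along a ray\<close>

lemma caustic_angle_has_real_derivative:
  assumes "(\<phi> has_real_derivative p) (at \<theta> within I)"
  shows "(caustic_angle \<phi> has_real_derivative 1 - p) (at \<theta> within I)"
  using assms unfolding caustic_angle_def by (auto intro!: derivative_eq_intros)

lemma ray_dir_has_vector_derivative:
  assumes "(\<phi> has_real_derivative p) (at \<theta> within I)"
  shows "(ray_dir \<phi> has_vector_derivative (1 - p) *\<^sub>R normal (caustic_angle \<phi> \<theta>)) (at \<theta> within I)"
  using tangent_has_vector_derivative[OF caustic_angle_has_real_derivative[OF assms]]
  by (simp add: ray_dir_eq_tangent[abs_def])

text \<open>The component across the ray is affine in \<open>t\<close> with slope
  \<open>1 - p\<close>, hence has exactly one zero, and the definite description in
  \<open>ray_length\<close> is legitimate. The assumption \<open>bot\<close> makes the derivative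
  \<open>v\<close> unique, so that \<open>v\<close> can be replaced by an explicit
  \<open>D t\<close>.\<close>

lemma ray_length_eq:
  assumes bot: "at \<theta> within I \<noteq> bot"
    and r: "(r has_vector_derivative R *\<^sub>R tangent \<theta>) (at \<theta> within I)"
    and \<phi>: "(\<phi> has_real_derivative p) (at \<theta> within I)"
    and p: "p \<noteq> 1"
  shows "ray_length r \<phi> I \<theta> = R * cos (\<phi> \<theta>) / (1 - p)"
proof -
  let ?\<alpha> = "caustic_angle \<phi> \<theta>"
  \<comment> \<open>The derivative of \<open>r + t \<nu>\<close> with \<open>t\<close> fixed,
    already resolved in the frame of the ray.\<close>
  define D where "D t = (R * sin (\<phi> \<theta>)) *\<^sub>R tangent ?\<alpha> + (t * (1 - p) - R * cos (\<phi> \<theta>)) *\<^sub>R normal ?\<alpha>" for t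
  have "D t = R *\<^sub>R tangent \<theta> + t *\<^sub>R (1 - p) *\<^sub>R normal ?\<alpha>" for t
    unfolding D_def tangent_in_caustic_frame[of \<theta> \<phi>]
    by (simp add: algebra_simps)
  then have D: "((\<lambda>s. r s + t *\<^sub>R ray_dir \<phi> s) has_vector_derivative D t) (at \<theta> within I)" for t
    using r ray_dir_has_vector_derivative[OF \<phi>]
    by (auto intro!: derivative_eq_intros)
  have "(\<exists>v. ((\<lambda>s. r s + t *\<^sub>R ray_dir \<phi> s) has_vector_derivative v) (at \<theta> within I) \<and>
           collinear {0, v, ray_dir \<phi> \<theta>}) \<longleftrightarrow> collinear {0, D t, ray_dir \<phi> \<theta>}" for t
    using D[of t] vector_derivative_unique_within[OF bot D[of t]] by blast
  also have "collinear {0, D t, ray_dir \<phi> \<theta>} \<longleftrightarrow> t = R * cos (\<phi> \<theta>) / (1 - p)" for t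
    using p by (simp only: D_def ray_dir_eq_tangent collinear_frame_iff) (simp add: field_simps)
  finally show ?thesis
    unfolding ray_length_def by simp
qed

section \<open>Uniqueness of derivatives and inverse functions on intervals\<close>

text \<open>A connected set with more than one point has no isolated points. This gives unique
  derivatives, also at endpoints belonging to \<open>I\<close>.\<close>

lemma at_within_interval_neq_bot:
  fixes I :: "real set"
  assumes "is_interval I" "interior I \<noteq> {}" "x \<in> I"
  shows "at x within I \<noteq> bot"
proof -
  have "I \<noteq> {y}" for y
    using assms(2) by auto
  then have "x islimpt I"
    using assms by (intro connected_imp_perfect) (auto simp: is_interval_connected_1)
  then show ?thesis
    by (simp add: trivial_limit_within)
qed

lemma inclination_equation_unique:
  assumes "inclination_equation r I R" "inclination_equation r I R'"
    and "\<theta> \<in> I" "at \<theta> within I \<noteq> bot"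
  shows "R \<theta> = R' \<theta>"
proof -
  have "R \<theta> *\<^sub>R tangent \<theta> = R' \<theta> *\<^sub>R tangent \<theta>"
    using assms(1-3) unfolding inclination_equation_def
    by (intro vector_derivative_unique_within[OF assms(4)]) auto
  then show ?thesis
    by simp
qed

text \<open>By the mean value theorem, a repeated value would force a zero of the derivative in
  between.\<close>

lemma inj_on_interval_if_derivative_nonzero:
  fixes f :: "real \<Rightarrow> real"
  assumes "is_interval I"
    and f: "\<And>x. x \<in> I \<Longrightarrow> (f has_real_derivative f' x) (at x within I)"
    and nz: "\<And>x. x \<in> I \<Longrightarrow> f' x \<noteq> 0"
  shows "inj_on f I"
proof (rule linorder_inj_onI)
  fix a b assume ab: "a < b" "a \<in> I" "b \<in> I"
  then have sub: "{a..b} \<subseteq> I"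
    using mem_is_interval_1_I[OF assms(1)] by (meson atLeastAtMost_iff subsetI)
  have "(f has_derivative (*) (f' x)) (at x within {a..b})" if "a \<le> x" "x \<le> b" for x
    using has_field_derivative_subset[OF f sub] sub that
    by (auto simp: has_field_derivative_def subset_iff)
  then obtain x where x: "x \<in> {a<..<b}" "f b - f a = f' x * (b - a)"
    using mvt_simple[of a b f "\<lambda>x. (*) (f' x)"] ab by blast
  then have "f' x \<noteq> 0"
    using sub by (intro nz) auto
  then have "f b - f a \<noteq> 0"
    using x(2) ab(1) by simp
  then show "f a \<noteq> f b"
    by simp
qed auto

lemma inv_into_interval_has_real_derivative:
  fixes f :: "real \<Rightarrow> real"
  assumes I: "is_interval I"
    and f: "\<And>x. x \<in> I \<Longrightarrow> (f has_real_derivative f' x) (at x within I)"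
    and nz: "\<And>x. x \<in> I \<Longrightarrow> f' x \<noteq> 0"
    and x: "x \<in> I"
  shows "(inv_into I f has_real_derivative 1 / f' x) (at (f x) within f ` I)"
proof -
  have inj: "inj_on f I"
    using inj_on_interval_if_derivative_nonzero I f nz by blast
  have "continuous_on I f"
    using f by (rule DERIV_continuous_on)
  with I inj obtain g where g: "homeomorphism I (f ` I) f g"
    using homeomorphism_into_1d[of I f "f ` I"] by (auto simp: is_interval_path_connected)
  then have "g y = inv_into I f y" if "y \<in> f ` I" for y
    using that inj by (auto simp: homeomorphism_apply1)
  with homeomorphism_cont2[OF g] have "continuous_on (f ` I) (inv_into I f)"
    by (rule continuous_on_eq)
  then have "continuous (at (f x) within f ` I) (inv_into I f)"
    using x by (simp add: continuous_on_eq_continuous_within)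
  then show ?thesis
    using f[OF x] x nz[OF x] inj unfolding has_field_derivative_def
    by (intro has_derivative_inverse_within[where f' = "(*) (f' x)"])
       (auto simp: o_def id_def bounded_linear.linear[OF bounded_linear_divide])
qed

section \<open>Radius of curvature of the caustic\<close>

text \<open>In the parameter \<theta> the caustic has velocity \<open>(1 - p) * \<rho>\<close> times
  its unit tangent. Passing to its own angle multiplies by \<open>1 / (1 - p)\<close> and leaves
  \<rho>, the left-hand side of the functional equation.\<close>

lemma inclination_equation_caustic:
  fixes p q R' :: "real \<Rightarrow> real"
  assumes I: "is_interval I" "interior I \<noteq> {}"
    and r: "inclination_equation r I R"
    and R: "\<And>\<theta>. \<theta> \<in> I \<Longrightarrow> (R has_real_derivative R' \<theta>) (at \<theta> within I)"
    and \<phi>: "\<And>\<theta>. \<theta> \<in> I \<Longrightarrow> (\<phi> has_real_derivative p \<theta>) (at \<theta> within I)"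
    and p: "\<And>\<theta>. \<theta> \<in> I \<Longrightarrow> (p has_real_derivative q \<theta>) (at \<theta> within I)"
    and p1: "\<And>\<theta>. \<theta> \<in> I \<Longrightarrow> p \<theta> \<noteq> 1"
  shows "inclination_equation (caustic_by_angle r \<phi> I) (caustic_angle \<phi> ` I)
    ((\<lambda>\<theta>. 1 / (1 - p \<theta>)\<^sup>2 *
         (((1 - 2 * p \<theta>) * sin (\<phi> \<theta>) + q \<theta> / (1 - p \<theta>) * cos (\<phi> \<theta>)) * R \<theta>
          + cos (\<phi> \<theta>) * R' \<theta>)) \<circ> inv_into I (caustic_angle \<phi>))"
    (is "inclination_equation _ _ (?\<rho> \<circ> _)")
  unfolding inclination_equation_def
proof
  let ?\<alpha> = "caustic_angle \<phi>" and ?c = "conormal_caustic r \<phi> I"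
  have \<alpha>: "(?\<alpha> has_real_derivative 1 - p \<theta>) (at \<theta> within I)" if "\<theta> \<in> I" for \<theta>
    using that by (rule caustic_angle_has_real_derivative[OF \<phi>])
  fix \<theta>\<^sub>1 assume "\<theta>\<^sub>1 \<in> ?\<alpha> ` I"
  then obtain \<theta> where \<theta>: "\<theta> \<in> I" and \<theta>\<^sub>1: "\<theta>\<^sub>1 = ?\<alpha> \<theta>"
    by blast
  have inv\<alpha>: "(inv_into I ?\<alpha> has_real_derivative 1 / (1 - p \<theta>)) (at \<theta>\<^sub>1 within ?\<alpha> ` I)"
    unfolding \<theta>\<^sub>1 using I(1) \<alpha> p1 \<theta> by (intro inv_into_interval_has_real_derivative) auto
  have inj: "inj_on ?\<alpha> I"
    using I(1) \<alpha> by (rule inj_on_interval_if_derivative_nonzero) (use p1 in auto)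
  then have inv_img: "inv_into I ?\<alpha> ` ?\<alpha> ` I = I" and inv\<theta>: "inv_into I ?\<alpha> \<theta>\<^sub>1 = \<theta>"
    using \<theta> by (simp_all add: \<theta>\<^sub>1)
  define t where "t \<theta> = R \<theta> * cos (\<phi> \<theta>) / (1 - p \<theta>)" for \<theta>
  \<comment> \<open>Quotient rule applied to \<open>t\<close>; \<open>q\<close> enters as the
    derivative of \<open>p\<close>.\<close>
  define t' where "t' = ((R' \<theta> * cos (\<phi> \<theta>) - R \<theta> * (sin (\<phi> \<theta>) * p \<theta>)) * (1 - p \<theta>)
      + R \<theta> * cos (\<phi> \<theta>) * q \<theta>) / (1 - p \<theta>)\<^sup>2"
  have dt: "(t has_real_derivative t') (at \<theta> within I)"
    unfolding t_def t'_def using R[OF \<theta>] \<phi>[OF \<theta>] p[OF \<theta>] p1[OF \<theta>]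
    by (auto intro!: derivative_eq_intros simp: power2_eq_square algebra_simps)
  have c_eq: "?c s = r s + t s *\<^sub>R ray_dir \<phi> s" if "s \<in> I" for s
    using ray_length_eq[OF at_within_interval_neq_bot[OF I that] _ \<phi>[OF that] p1[OF that]]
      r that unfolding inclination_equation_def conormal_caustic_def t_def by simp
  have speed: "R \<theta> * sin (\<phi> \<theta>) + t' = (1 - p \<theta>) * ?\<rho> \<theta>"
  proof -
    \<comment> \<open>Naming the nonzero denominator \<open>1 - p \<theta>\<close> as an atom lets
      \<open>field_simps\<close> clear fractions.\<close>
    obtain d where d: "p \<theta> = 1 - d" "d \<noteq> 0"
      using that[of "1 - p \<theta>"] p1[OF \<theta>] by simp
    show ?thesis
      unfolding t'_def d(1) using d(2) by (simp add: field_simps power2_eq_square)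
  qed
  have "((\<lambda>s. r s + t s *\<^sub>R ray_dir \<phi> s) has_vector_derivative
      R \<theta> *\<^sub>R tangent \<theta> + (t \<theta> *\<^sub>R (1 - p \<theta>) *\<^sub>R normal (?\<alpha> \<theta>) + t' *\<^sub>R ray_dir \<phi> \<theta>)) (at \<theta> within I)"
    using r \<theta> dt ray_dir_has_vector_derivative[OF \<phi>[OF \<theta>]] unfolding inclination_equation_def
    by (intro has_vector_derivative_add has_vector_derivative_scaleR) auto
  \<comment> \<open>The choice of \<open>t\<close> makes the normal components cancel, so only the
    tangential direction survives.\<close>
  also have "R \<theta> *\<^sub>R tangent \<theta> + (t \<theta> *\<^sub>R (1 - p \<theta>) *\<^sub>R normal (?\<alpha> \<theta>) + t' *\<^sub>R ray_dir \<phi> \<theta>) =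
      (R \<theta> * sin (\<phi> \<theta>) + t') *\<^sub>R tangent (?\<alpha> \<theta>)"
  proof -
    have "t \<theta> *\<^sub>R (1 - p \<theta>) *\<^sub>R normal (?\<alpha> \<theta>) = (R \<theta> * cos (\<phi> \<theta>)) *\<^sub>R normal (?\<alpha> \<theta>)"
      using p1[OF \<theta>] by (simp add: t_def)
    then show ?thesis
      unfolding tangent_in_caustic_frame[of \<theta> \<phi>] ray_dir_eq_tangent
      by (simp only:) (simp add: algebra_simps)
  qed
  also note speed
  finally have "(?c has_vector_derivative ((1 - p \<theta>) * ?\<rho> \<theta>) *\<^sub>R tangent (?\<alpha> \<theta>)) (at \<theta> within I)"
    by (rule has_vector_derivative_transform[OF \<theta>, rotated]) (rule c_eq)
  \<comment> \<open>Base point and set are rewritten as images under the inverse angle, the shape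
    demanded by the chain rule.\<close>
  then have "(?c has_vector_derivative ((1 - p \<theta>) * ?\<rho> \<theta>) *\<^sub>R tangent \<theta>\<^sub>1)
      (at (inv_into I ?\<alpha> \<theta>\<^sub>1) within inv_into I ?\<alpha> ` ?\<alpha> ` I)"
    unfolding inv_img inv\<theta> by (simp only: \<theta>\<^sub>1)
  from vector_diff_chain_within[OF inv\<alpha>[unfolded has_real_derivative_iff_has_vector_derivative] this]
  show "(caustic_by_angle r \<phi> I has_vector_derivative (?\<rho> \<circ> inv_into I ?\<alpha>) \<theta>\<^sub>1 *\<^sub>R tangent \<theta>\<^sub>1)
      (at \<theta>\<^sub>1 within ?\<alpha> ` I)"
    using p1[OF \<theta>] by (simp add: caustic_by_angle_def inv\<theta>)
qed

section \<open>Similarity expressed by the functional equation\<close>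

lemma smooth_on_has_real_derivative:
  assumes "smooth_on I f" "\<theta> \<in> I"
  shows "((deriv_on I ^^ n) f has_real_derivative (deriv_on I ^^ Suc n) f \<theta>) (at \<theta> within I)"
proof -
  have "(deriv_on I ^^ n) f differentiable at \<theta> within I"
    using assms by (auto simp: smooth_on_def differentiable_on_def)
  then show ?thesis
    by (simp add: has_real_derivative_iff_has_vector_derivative vector_derivative_works deriv_on_def)
qed

text \<open>Similarity quantifies over radii of curvature existentially, but each curve determines
  its own, so any given pair may be used instead.\<close>

lemma similar_curves_iff:
  assumes r: "inclination_equation r I R" and c: "inclination_equation c J R\<^sub>1"
    and I: "\<And>\<theta>. \<theta> \<in> I \<Longrightarrow> at \<theta> within I \<noteq> bot"
    and J: "\<And>\<theta>. \<theta> \<in> J \<Longrightarrow> at \<theta> within J \<noteq> bot"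
  shows "similar_curves r I c J \<longleftrightarrow>
    (\<exists>a \<beta>. \<exists>\<sigma>\<in>{1, -1}. \<forall>\<theta>\<in>J. \<sigma> * (\<theta> - \<beta>) \<in> I \<and> R\<^sub>1 \<theta> = a * R (\<sigma> * (\<theta> - \<beta>)))"
    (is "_ \<longleftrightarrow> ?rhs")
proof
  assume "similar_curves r I c J"
  then obtain S S\<^sub>1 a \<beta> \<sigma> where S: "inclination_equation r I S" "inclination_equation c J S\<^sub>1"
    and \<sigma>: "\<sigma> \<in> {1, -1}"
    and sim: "\<And>\<theta>. \<theta> \<in> J \<Longrightarrow> \<sigma> * (\<theta> - \<beta>) \<in> I \<and> S\<^sub>1 \<theta> = a * S (\<sigma> * (\<theta> - \<beta>))"
    unfolding similar_curves_def by blast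
  have "\<sigma> * (\<theta> - \<beta>) \<in> I \<and> R\<^sub>1 \<theta> = a * R (\<sigma> * (\<theta> - \<beta>))" if "\<theta> \<in> J" for \<theta>
    \<comment> \<open>Uniqueness for \<open>r\<close> is applied at
      \<open>\<sigma> * (\<theta> - \<beta>)\<close>, which similarity places in
      \<open>I\<close>.\<close>
    using sim[OF that] inclination_equation_unique[OF r S(1) _ I]
      inclination_equation_unique[OF c S(2) that J[OF that]] by metis
  with \<sigma> show ?rhs
    by blast
next
  assume ?rhs
  with r c show "similar_curves r I c J"
    unfolding similar_curves_def by blast
qed

theorem corollary1:
  fixes r :: "real \<Rightarrow> real \<times> real" and R \<phi> :: "real \<Rightarrow> real" and I :: "real set"
  assumes "is_interval I" and "interior I \<noteq> {}"
    and "smooth_on I R"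
    and "inclination_equation r I R"
    and "smooth_on I \<phi>"
    and "\<And>\<theta>. \<theta> \<in> I \<Longrightarrow> deriv_on I \<phi> \<theta> \<noteq> 1"
  shows "similar_curves r I (caustic_by_angle r \<phi> I) (caustic_angle \<phi> ` I) \<longleftrightarrow>
    (\<exists>a \<beta>. \<exists>\<sigma>\<in>{1, -1}. \<forall>\<theta>\<in>I.
       \<sigma> * (\<theta> + pi / 2 - \<phi> \<theta> - \<beta>) \<in> I \<and>
       1 / (1 - deriv_on I \<phi> \<theta>)\<^sup>2 *
         (((1 - 2 * deriv_on I \<phi> \<theta>) * sin (\<phi> \<theta>)
            + deriv_on I (deriv_on I \<phi>) \<theta> / (1 - deriv_on I \<phi> \<theta>) * cos (\<phi> \<theta>)) * R \<theta>
          + cos (\<phi> \<theta>) * deriv_on I R \<theta>)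
       = a * R (\<sigma> * (\<theta> + pi / 2 - \<phi> \<theta> - \<beta>)))"
proof -
  let ?\<alpha> = "caustic_angle \<phi>"
  let ?\<rho> = "\<lambda>\<theta>. 1 / (1 - deriv_on I \<phi> \<theta>)\<^sup>2 *
         (((1 - 2 * deriv_on I \<phi> \<theta>) * sin (\<phi> \<theta>)
            + deriv_on I (deriv_on I \<phi>) \<theta> / (1 - deriv_on I \<phi> \<theta>) * cos (\<phi> \<theta>)) * R \<theta>
          + cos (\<phi> \<theta>) * deriv_on I R \<theta>)"
  note I = assms(1,2)
  have R: "(R has_real_derivative deriv_on I R \<theta>) (at \<theta> within I)"
    and \<phi>: "(\<phi> has_real_derivative deriv_on I \<phi> \<theta>) (at \<theta> within I)"
    and p: "(deriv_on I \<phi> has_real_derivative deriv_on I (deriv_on I \<phi>) \<theta>) (at \<theta> within I)"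
    if "\<theta> \<in> I" for \<theta>
    using smooth_on_has_real_derivative[OF assms(3) that, of 0]
      smooth_on_has_real_derivative[OF assms(5) that, of 0]
      smooth_on_has_real_derivative[OF assms(5) that, of 1] by simp_all
  have \<alpha>: "(?\<alpha> has_real_derivative 1 - deriv_on I \<phi> \<theta>) (at \<theta> within I)" if "\<theta> \<in> I" for \<theta>
    using that by (rule caustic_angle_has_real_derivative[OF \<phi>])
  have inj: "inj_on ?\<alpha> I"
    using I(1) \<alpha> by (rule inj_on_interval_if_derivative_nonzero) (use assms(6) in auto)
  have "connected (?\<alpha> ` I)"
    using I(1) DERIV_continuous_on[OF \<alpha>]
    by (auto simp: is_interval_connected_1 intro!: connected_continuous_image)
  \<comment> \<open>The range of angles is connected; were it a single point, injectivity would make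
    \<open>I\<close> finite, against its nonempty interior. So it has no isolated points.\<close>
  moreover have "?\<alpha> ` I \<noteq> {y}" for y
  proof
    assume "?\<alpha> ` I = {y}"
    then have "finite I"
      using finite_imageD[OF _ inj] by simp
    then show False
      using I(2) by (simp add: empty_interior_finite)
  qed
  ultimately have J: "at \<theta> within ?\<alpha> ` I \<noteq> bot" if "\<theta> \<in> ?\<alpha> ` I" for \<theta>
    using connected_imp_perfect[OF _ that] by (simp add: trivial_limit_within)
  have caustic: "inclination_equation (caustic_by_angle r \<phi> I) (?\<alpha> ` I) (?\<rho> \<circ> inv_into I ?\<alpha>)"
    by (rule inclination_equation_caustic[OF I assms(4)]) (fact R \<phi> p assms(6))+
  have "similar_curves r I (caustic_by_angle r \<phi> I) (?\<alpha> ` I) \<longleftrightarrow>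
      (\<exists>a \<beta>. \<exists>\<sigma>\<in>{1, -1}. \<forall>\<theta>\<in>?\<alpha> ` I.
        \<sigma> * (\<theta> - \<beta>) \<in> I \<and> (?\<rho> \<circ> inv_into I ?\<alpha>) \<theta> = a * R (\<sigma> * (\<theta> - \<beta>)))"
    by (rule similar_curves_iff[OF assms(4) caustic]) (fact at_within_interval_neq_bot[OF I] J)+
  \<comment> \<open>Substituting the caustic angle for the bound variable moves the condition from
    the range of angles to \<open>I\<close>; injectivity cancels \<open>inv_into\<close>.\<close>
  also have "\<dots> \<longleftrightarrow> (\<exists>a \<beta>. \<exists>\<sigma>\<in>{1, -1}. \<forall>\<theta>\<in>I.
        \<sigma> * (?\<alpha> \<theta> - \<beta>) \<in> I \<and> ?\<rho> \<theta> = a * R (\<sigma> * (?\<alpha> \<theta> - \<beta>)))"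
    unfolding ball_simps o_def using inj
    by (intro ex_cong1 bex_cong ball_cong refl) simp_all
  finally show ?thesis
    unfolding caustic_angle_def .
qed

end
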